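(* Let $\Sigma$ be an arbitrary assignment of the labels occupied/unoccupied to the leaves of $T_{\mathrm{saw}}(\mathbb{Z}^2)$, and let $T_{\mathrm{saw}}^\Sigma(\mathbb{Z}^2)$ be the tree obtained from $T_{\mathrm{saw}}(\mathbb{Z}^2)$ by deleting the unoccupied leaves and, for each occupied leaf, deleting that leaf's parent together with the whole subtree rooted at the parent. Then $T_{\boldsymbol{D}_G}$ is a subtree of $T_{\mathrm{saw}}^\Sigma(\mathbb{Z}^2)$, i.e., every walk that is a vertex of $T_{\boldsymbol{D}_G}$ is a vertex of $T_{\mathrm{saw}}^\Sigma(\mathbb{Z}^2)$.
   Context: Steps in $\mathbb{Z}^2$: $N=(0,1),S=(0,-1),E=(1,0),W=(-1,0)$. $T_{\mathrm{saw}}(\mathbb{Z}^2)$ is the rooted tree whose vertices are the walks $(v_0,\dots,v_m)$ with $v_0$ the origin, $v_0,\dots,v_{m-1}$ distinct, $v_m\ne v_{m-2}$, and either $v_m\notin\{v_0,\dots,v_{m-1}\}$ or $v_m=v_i$ for some $i$ (these walks closing a cycle are the leaves); the parent of a walk is the walk with its last step removed. $T_{\boldsymbol{D}_G}$ is the rooted tree of walks from the origin generated by the following state rules, where each state name's last letter is the step just taken and a vertex in a state has one child for each listed state (the child extends the walk by the last letter of its state): $O\to N\,|\,E\,|\,W$ (root), $N\to NN\,|\,NE\,|\,NW$, $W\to WN\,|\,WW$, $E\to EN\,|\,EE$, $NN\to NN\,|\,NE\,|\,NW$, $NW\to WN\,|\,WW$, $NE\to EN\,|\,EE$, $WW\to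 WN\,|\,WW$, $EE\to EN\,|\,EE$, $WN\to NW\,|\,NN$, $EN\to NE\,|\,NN$. Equivalently, its vertices are the walks from the origin with steps in $\{N,E,W\}$ whose step sequence contains none of the consecutive substrings $EW,WE,ENW,WNE$. *)

theory Defs
  imports "HOL-Library.Sublist" "HOL-Library.Product_Plus"
begin

type_synonym point = "int \<times> int"

datatype dir = North | South | East | West

fun step :: "dir \<Rightarrow> point" where
  "step North = (0, 1)"
| "step South = (0, -1)"
| "step East = (1, 0)"
| "step West = (-1, 0)"

(* A walk (v_0, ..., v_m) is the nonempty list [v_0, ..., v_m]; all walks start at the origin.
   A rooted tree of walks is given by its set of vertices: the root is [(0, 0)] and the parent
   of w is butlast w. Hence the ancestors of w (with w itself) are its nonempty prefixes, and
   one such tree is a subtree of another iff its vertices form a subset. *)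
type_synonym walk = "point list"

definition is_walk :: "walk \<Rightarrow> bool" where
  "is_walk w \<longleftrightarrow> w \<noteq> [] \<and> hd w = (0, 0) \<and>
     (\<forall>i. Suc i < length w \<longrightarrow> (\<exists>d. w ! Suc i = w ! i + step d))"

(* For w = [v_0, ..., v_m] we have length w = m + 1, so v_{m-2} is w ! (length w - 3). *)
definition T_saw :: "walk set" where
  "T_saw = {w. is_walk w \<and> distinct (butlast w) \<and>
               (3 \<le> length w \<longrightarrow> last w \<noteq> w ! (length w - 3))}"

definition T_saw_leaves :: "walk set" where
  "T_saw_leaves = {w \<in> T_saw. last w \<in> set (butlast w)}"

datatype label = Occupied | Unoccupied

definition subtree_at :: "walk set \<Rightarrow> walk \<Rightarrow> walk set" where
  "subtree_at T p = {w \<in> T. prefix p w}"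

(* Only the values of the labelling on T_saw_leaves matter. *)
definition T_saw_labelled :: "(walk \<Rightarrow> label) \<Rightarrow> walk set" where
  "T_saw_labelled \<Sigma> = T_saw
     - {l \<in> T_saw_leaves. \<Sigma> l = Unoccupied}
     - (\<Union>l \<in> {l \<in> T_saw_leaves. \<Sigma> l = Occupied}. subtree_at T_saw (butlast l))"

datatype state =
    St_O | St_N | St_W | St_E | St_NN | St_NW | St_NE | St_WW | St_EE | St_WN | St_EN

fun children :: "state \<Rightarrow> state set" where
  "children St_O = {St_N, St_E, St_W}"
| "children St_N = {St_NN, St_NE, St_NW}"
| "children St_W = {St_WN, St_WW}"
| "children St_E = {St_EN, St_EE}"
| "children St_NN = {St_NN, St_NE, St_NW}"
| "children St_NW = {St_WN, St_WW}"
| "children St_NE = {St_EN, St_EE}"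
| "children St_WW = {St_WN, St_WW}"
| "children St_EE = {St_EN, St_EE}"
| "children St_WN = {St_NW, St_NN}"
| "children St_EN = {St_NE, St_NN}"

(* The step just taken on entering a state. The root state is entered by no step and is
   not a child of any state, so there is no equation for it. *)
fun last_dir :: "state \<Rightarrow> dir" where
  "last_dir St_N = North"
| "last_dir St_W = West"
| "last_dir St_E = East"
| "last_dir St_NN = North"
| "last_dir St_NW = West"
| "last_dir St_NE = East"
| "last_dir St_WW = West"
| "last_dir St_EE = East"
| "last_dir St_WN = North"
| "last_dir St_EN = North"

inductive has_state :: "walk \<Rightarrow> state \<Rightarrow> bool" where
  root: "has_state [(0, 0)] St_O"
| child: "has_state w s \<Longrightarrow> t \<in> children s \<Longrightarrow>
            has_state (w @ [last w + step (last_dir t)]) t"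

(* The children of a state have pairwise distinct last letters, so a walk has at most one
   state and vertices of the generated tree may be identified with walks. *)
definition T_D\<^sub>G :: "walk set" where
  "T_D\<^sub>G = {w. \<exists>s. has_state w s}"

end

theory Submission
  imports Defs
begin

text \<open>
  A walk of the generated tree never goes down and never reverses a horizontal run, nor does it
  turn back above the run it has just left. Hence the only visited neighbour of its endpoint
  \<open>(x, y)\<close> is its predecessor. This is shown by an invariant recording, for each state, where the
  visited points of the rows \<open>y\<close> and \<open>y - 1\<close> lie relative to \<open>x\<close>. Since the tree is closed under
  prefixes, no prefix of such a walk is the parent of a leaf of \<open>T_saw\<close>, so no labelling of the
  leaves can delete the walk.
\<close>

text \<open>\<open>d\<close> is the horizontal offset of a visited point from the endpoint. A
  horizontal run trails behind its endpoint; after a step North the row is new.\<close>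

fun current_row :: "state \<Rightarrow> int \<Rightarrow> bool" where
  "current_row s d \<longleftrightarrow>
     (if s \<in> {St_W, St_WW, St_NW} then d \<ge> 0
      else if s \<in> {St_E, St_EE, St_NE} then d \<le> 0
      else d = 0)"

text \<open>Strict bounds keep the point under a horizontal step free. The weak ones describe the
  run just left, which ends at the predecessor, where \<open>d = 0\<close>.\<close>

fun row_below :: "state \<Rightarrow> int \<Rightarrow> bool" where
  "row_below s d \<longleftrightarrow>
     (if s \<in> {St_W, St_WW, St_NW} then d > 0
      else if s \<in> {St_E, St_EE, St_NE} then d < 0
      else if s = St_WN then d \<ge> 0
      else if s = St_EN then d \<le> 0
      else s \<noteq> St_O \<and> d = 0)"

definition confined :: "state \<Rightarrow> point \<Rightarrow> point set \<Rightarrow> bool" where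
  "confined s p V \<longleftrightarrow> (\<forall>q\<in>V. snd q \<le> snd p \<and>
     (snd q = snd p \<longrightarrow> current_row s (fst q - fst p)) \<and>
     (snd q = snd p - 1 \<longrightarrow> row_below s (fst q - fst p)))"

lemma has_state_nonempty: "has_state w s \<Longrightarrow> w \<noteq> []"
  by (induction rule: has_state.induct) auto

text \<open>A step North turns the current row into the row below; a horizontal step shifts all
  offsets by one, away from the direction of the step.\<close>

lemma confined_child:
  assumes "confined s p V" "t \<in> children s"
  shows "confined t (p + step (last_dir t)) (insert (p + step (last_dir t)) V)"
  using assms by (cases p; cases s) (fastforce simp: confined_def)+

lemma confined_child_fresh:
  assumes "confined s p V" "t \<in> children s"
  shows "p + step (last_dir t) \<notin> V"
  using assms by (cases p; cases s) (fastforce simp: confined_def)+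

lemma has_state_confined: "has_state w s \<Longrightarrow> confined s (last w) (set w)"
proof (induction rule: has_state.induct)
  case root
  show ?case by (simp add: confined_def)
next
  case (child w s t)
  then show ?case using confined_child by simp
qed

lemma has_state_distinct: "has_state w s \<Longrightarrow> distinct w"
proof (induction rule: has_state.induct)
  case (child w s t)
  then show ?case using confined_child_fresh[OF has_state_confined] by simp
qed simp

lemma has_state_is_walk: "has_state w s \<Longrightarrow> is_walk w"
proof (induction rule: has_state.induct)
  case root
  show ?case by (simp add: is_walk_def)
next
  case (child w s t)
  let ?w = "w @ [last w + step (last_dir t)]"
  have ne: "w \<noteq> []" using child.hyps has_state_nonempty by blast
  have "\<exists>d. ?w ! Suc i = ?w ! i + step d" if "Suc i < length ?w" for i
  proof (cases "Suc i < length w")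
    case True
    then show ?thesis using child.IH by (simp add: is_walk_def nth_append)
  next
    case False
    then have "i = length w - 1" "Suc i = length w" using that by auto
    then show ?thesis using ne by (auto simp: nth_append last_conv_nth)
  qed
  then show ?case using child.IH by (simp add: is_walk_def)
qed

lemma has_state_butlast:
  assumes "has_state w s" "s \<noteq> St_O"
  shows "2 \<le> length w" "w ! (length w - 2) = last w - step (last_dir s)"
  using assms
proof (induction rule: has_state.induct)
  case (child w s t)
  have "w \<noteq> []" using child.hyps has_state_nonempty by blast
  moreover from this have "length w = Suc (length w - 1)" by simp
  ultimately show "2 \<le> length (w @ [last w + step (last_dir t)])"
    "(w @ [last w + step (last_dir t)]) ! (length (w @ [last w + step (last_dir t)]) - 2)
      = last (w @ [last w + step (last_dir t)]) - step (last_dir t)"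
    by (simp_all add: nth_append last_conv_nth numeral_2_eq_2 Suc_le_eq)
qed auto

text \<open>North is free because nothing visited lies higher. Of the other three neighbours, the
  row bounds admit only the one opposite to the last step, and none at the root.\<close>

lemma confined_neighbour:
  assumes "confined s p V" "p + step d \<in> V"
  shows "s \<noteq> St_O \<and> p + step d = p - step (last_dir s)"
  using assms by (cases p; cases s; cases d) (fastforce simp: confined_def)+

lemma has_state_prefix:
  assumes "has_state w s" "prefix p w" "p \<noteq> []"
  shows "\<exists>t. has_state p t"
  using assms
proof (induction rule: has_state.induct)
  case root
  then show ?case using has_state.root by (auto simp: prefix_Cons)
next
  case (child w s t)
  then show ?case using has_state.child by (auto simp: prefix_snoc)
qed

text \<open>The final step of a leaf reaches a visited neighbour of the parent's endpoint. If the
  parent had a state, this could only be its predecessor, a reversal forbidden in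
  \<open>T_saw\<close>.\<close>

lemma butlast_T_saw_leaf_no_state:
  assumes "l \<in> T_saw_leaves"
  shows "\<not> has_state (butlast l) s"
proof
  assume st: "has_state (butlast l) s"
  let ?p = "butlast l" and ?n = "length l"
  have walk: "is_walk l" and no_reversal: "3 \<le> ?n \<Longrightarrow> last l \<noteq> l ! (?n - 3)"
    and visited: "last l \<in> set ?p"
    using assms by (auto simp: T_saw_leaves_def T_saw_def)
  have ne: "?p \<noteq> []" using st has_state_nonempty by blast
  then have n: "2 \<le> ?n" by (cases l rule: rev_cases) (auto simp: Suc_le_eq)
  have "Suc (?n - 2) < ?n" using n by simp
  then obtain d where "l ! Suc (?n - 2) = l ! (?n - 2) + step d"
    using walk unfolding is_walk_def by blast
  moreover have "last l = l ! Suc (?n - 2)"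
    using n by (subst last_conv_nth) (auto intro: arg_cong[where f = "(!) l"])
  moreover have "last ?p = l ! (?n - 2)"
    using n ne by (simp add: last_conv_nth nth_butlast numeral_2_eq_2)
  ultimately have last: "last l = last ?p + step d" by simp
  have "s \<noteq> St_O" and "last l = last ?p - step (last_dir s)"
    using confined_neighbour[OF has_state_confined[OF st]] visited last by auto
  then have len: "2 \<le> length ?p" and "last l = ?p ! (length ?p - 2)"
    using has_state_butlast[OF st] by auto
  \<comment> \<open>\<open>?p\<close> is one shorter than \<open>l\<close>, so its penultimate
    vertex is the one that \<open>T_saw\<close> compares with \<open>last l\<close>.\<close>
  moreover have "?p ! (length ?p - 2) = l ! (?n - 3)"
    using len by (subst nth_butlast) (auto simp: numeral_eq_Suc)
  moreover have "3 \<le> ?n" using len by simp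
  ultimately show False using no_reversal by simp
qed

lemma has_state_T_saw:
  assumes "has_state w s"
  shows "w \<in> T_saw"
proof -
  have dist: "distinct w" using assms has_state_distinct by blast
  \<comment> \<open>Two different positions of a distinct list.\<close>
  have "last w \<noteq> w ! (length w - 3)" if "3 \<le> length w"
  proof -
    have "last w = w ! (length w - 1)" using that by (intro last_conv_nth) auto
    then show ?thesis using that dist by (simp add: nth_eq_iff_index_eq)
  qed
  then show ?thesis
    using dist has_state_is_walk[OF assms] by (simp add: T_saw_def distinct_butlast)
qed

lemma T_saw_leaf_not_distinct:
  assumes "l \<in> T_saw_leaves"
  shows "\<not> distinct l"
  using assms by (cases l rule: rev_cases) (auto simp: T_saw_leaves_def)

theorem theorem3:
  fixes \<Sigma> :: "walk \<Rightarrow> label"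
  shows "T_D\<^sub>G \<subseteq> T_saw_labelled \<Sigma>"
proof
  fix w assume "w \<in> T_D\<^sub>G"
  then obtain s where st: "has_state w s" by (auto simp: T_D\<^sub>G_def)
  have "w \<notin> T_saw_leaves"
    using T_saw_leaf_not_distinct has_state_distinct[OF st] by blast
  \<comment> \<open>This rules out deletion through any leaf, whatever its label.\<close>
  moreover have "\<not> prefix (butlast l) w" if l: "l \<in> T_saw_leaves" for l
  proof -
    have "butlast l \<noteq> []" using l by (auto simp: T_saw_leaves_def)
    then show ?thesis
      using butlast_T_saw_leaf_no_state[OF l] has_state_prefix[OF st] by blast
  qed
  ultimately show "w \<in> T_saw_labelled \<Sigma>"
    using has_state_T_saw[OF st] by (auto simp: T_saw_labelled_def subtree_at_def)
qed

end
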